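(* If $\omega\subseteq X\subseteq\beta\omega$ and $\operatorname{CL}(X)$ is pseudocompact, then $\operatorname{CL}(X)$ is $(\kappa,\omega^* )$-pseudocompact for every cardinal $\kappa<\mathfrak h$.
   Context: $\beta\omega$ is the Stone–Čech compactification of the discrete space $\omega$, $\omega^*$ the set of free ultrafilters on $\omega$. $\mathfrak h$ is the least cardinality of a family of open dense subsets of $([\omega]^\omega,\subseteq^* )$ with empty intersection (a family $\mathcal D\subseteq[\omega]^\omega$ is open dense if every $A\in[\omega]^\omega$ contains some $B\in\mathcal D$, and $\mathcal D$ is closed under infinite $\subseteq^*$-subsets). $\operatorname{CL}(X)$ is the set of nonempty closed subsets of $X$ with the Vietoris topology; pseudocompact means every continuous real-valued function is bounded. For $p\in\omega^*$ and a sequence $(B_n)$ of subsets of a space $Z$, $z$ is a $p$-limit of $(B_n)$ if $\{n:V\cap B_n\ne\emptyset\}\in p$ for every neighborhood $V$ of $z$; $Z$ is $(\kappa,\omega^* )$-pseudocompact if for every family $\{(V^\alpha_n:n\in\omega):\alpha<\kappa\}$ of sequences of nonempty open subsets of $Z$ there is a single $p\in\omega^*$ such that each $(V^\alpha_n:n\in\omega)$ has a $p$-limit point in $Z$. *)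

theory Defs
  imports "HOL-Analysis.Analysis"
begin

definition ultrafilter_nat :: "nat set set \<Rightarrow> bool" where
  "ultrafilter_nat U \<longleftrightarrow>
     {} \<notin> U \<and> UNIV \<in> U \<and>
     (\<forall>A B. A \<in> U \<and> A \<subseteq> B \<longrightarrow> B \<in> U) \<and>
     (\<forall>A B. A \<in> U \<and> B \<in> U \<longrightarrow> A \<inter> B \<in> U) \<and>
     (\<forall>A. A \<in> U \<or> - A \<in> U)"

definition free_ultrafilter_nat :: "nat set set \<Rightarrow> bool" where
  "free_ultrafilter_nat U \<longleftrightarrow> ultrafilter_nat U \<and> (\<forall>A. finite A \<longrightarrow> A \<notin> U)"

definition omega_star :: "nat set set set" where
  "omega_star = {U. free_ultrafilter_nat U}"

text \<open>The embedding of omega into beta omega (principal ultrafilters).\<close>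
definition principal_uf :: "nat \<Rightarrow> nat set set" where
  "principal_uf n = {A. n \<in> A}"

definition beta_omega :: "nat set set topology" where
  "beta_omega = topology_generated_by {{U. ultrafilter_nat U \<and> A \<in> U} | A. True}"

definition CL :: "'a topology \<Rightarrow> 'a set set" where
  "CL T = {F. closedin T F \<and> F \<noteq> {}}"

definition vietoris :: "'a topology \<Rightarrow> 'a set topology" where
  "vietoris T = topology_generated_by
     ({{F \<in> CL T. F \<subseteq> U} | U. openin T U} \<union>
      {{F \<in> CL T. F \<inter> U \<noteq> {}} | U. openin T U})"

definition pseudocompact :: "'a topology \<Rightarrow> bool" where
  "pseudocompact Z \<longleftrightarrow>
     (\<forall>f. continuous_map Z euclideanreal f \<longrightarrow> bounded (f ` topspace Z))"

definition p_limit :: "'a topology \<Rightarrow> nat set set \<Rightarrow> (nat \<Rightarrow> 'a set) \<Rightarrow> 'a \<Rightarrow> bool" where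
  "p_limit Z p B z \<longleftrightarrow> z \<in> topspace Z \<and>
     (\<forall>V. openin Z V \<and> z \<in> V \<longrightarrow> {n. V \<inter> B n \<noteq> {}} \<in> p)"

text \<open>(kappa, omega*)-pseudocompactness, with kappa the cardinality of the index set I.\<close>
definition kappa_omega_star_pseudocompact :: "'i set \<Rightarrow> 'a topology \<Rightarrow> bool" where
  "kappa_omega_star_pseudocompact I Z \<longleftrightarrow>
     (\<forall>V :: 'i \<Rightarrow> nat \<Rightarrow> 'a set.
        (\<forall>i\<in>I. \<forall>n. openin Z (V i n) \<and> V i n \<noteq> {}) \<longrightarrow>
        (\<exists>p \<in> omega_star. \<forall>i\<in>I. \<exists>z. p_limit Z p (V i) z))"

definition open_dense_inf :: "nat set set \<Rightarrow> bool" where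
  "open_dense_inf D \<longleftrightarrow>
     (\<forall>B\<in>D. infinite B) \<and>
     (\<forall>A. infinite A \<longrightarrow> (\<exists>B\<in>D. B \<subseteq> A)) \<and>
     (\<forall>B\<in>D. \<forall>C. infinite C \<and> finite (C - B) \<longrightarrow> C \<in> D)"

text \<open>|I| < h: every family of open dense subsets of ([omega]^omega, subset*) with
  empty intersection (in [omega]^omega) has cardinality strictly larger than |I|.\<close>
definition less_than_h :: "'i set \<Rightarrow> bool" where
  "less_than_h I \<longleftrightarrow>
     (\<forall>\<D> :: nat set set set.
        (\<forall>D\<in>\<D>. open_dense_inf D) \<and> {A. infinite A \<and> (\<forall>D\<in>\<D>. A \<in> D)} = {}
        \<longrightarrow> (card_of I, card_of \<D>) \<in> ordLess)"

end

theory Submission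
  imports Defs
begin

text \<open>
  Finite subsets of \<open>\<omega>\<close> are isolated points of \<open>CL(X)\<close> and form a dense set, so only
  \<open>p\<close>-limits of sequences of finite sets matter. If \<open>CL(X)\<close> is pseudocompact, then a sequence
  of pairwise disjoint finite sets \<open>G\<^sub>k\<close> has a \<open>p\<close>-limit \<open>K\<close> for some free \<open>p\<close>; for each selector
  \<open>f \<in> \<Prod>G\<^sub>k\<close> the range of \<open>f\<close> isolates the image ultrafilter \<open>f(p)\<close> in the \<open>p\<close>-limit, and hence
  \<open>f(p) \<in> X\<close>. Given fewer than \<open>\<hh>\<close> sequences of finite sets, one infinite \<open>A \<subseteq> \<omega>\<close> can be found
  along which each sequence, up to a convergent initial part, is almost contained in a
  single sequence of pairwise disjoint intervals \<open>G\<^sub>k\<close>. The ultrafilter \<open>p\<close> obtained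
  from \<open>G\<close> then serves all of them at once, because image ultrafilters of selectors are dense
  in the \<open>p\<close>-limits.
\<close>

section \<open>Ultrafilters on the natural numbers\<close>

lemma ultrafilter_natD:
  assumes "ultrafilter_nat U"
  shows ultrafilter_nat_empty: "{} \<notin> U"
    and ultrafilter_nat_UNIV: "UNIV \<in> U"
    and ultrafilter_nat_mono: "A \<in> U \<Longrightarrow> A \<subseteq> B \<Longrightarrow> B \<in> U"
    and ultrafilter_nat_Int: "A \<in> U \<Longrightarrow> B \<in> U \<Longrightarrow> A \<inter> B \<in> U"
    and ultrafilter_nat_Compl_iff: "- A \<in> U \<longleftrightarrow> A \<notin> U"
proof -
  show *: "{} \<notin> U" "UNIV \<in> U" "A \<in> U \<Longrightarrow> A \<subseteq> B \<Longrightarrow> B \<in> U" 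
    "A \<in> U \<Longrightarrow> B \<in> U \<Longrightarrow> A \<inter> B \<in> U" for A B
    using assms unfolding ultrafilter_nat_def by blast+
  show "- A \<in> U \<longleftrightarrow> A \<notin> U"
    using assms *(1) *(4)[of A "- A"] unfolding ultrafilter_nat_def by auto
qed

text \<open>Maximality of ultrafilters: a set of \<open>W\<close> missing from \<open>U\<close>
  would have its complement in \<open>U\<close>, hence in \<open>W\<close>. One inclusion thus
  suffices to identify two ultrafilters.\<close>

lemma ultrafilter_nat_subset_eq:
  assumes "ultrafilter_nat U" "ultrafilter_nat W" "U \<subseteq> W"
  shows "U = W"
proof
  show "W \<subseteq> U"
  proof
    fix A assume "A \<in> W"
    then have "- A \<notin> W" using ultrafilter_nat_Compl_iff[OF assms(2)] by blast
    then show "A \<in> U" using assms(3) ultrafilter_nat_Compl_iff[OF assms(1)] by blast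
  qed
qed fact

lemma ultrafilter_principal_uf: "ultrafilter_nat (principal_uf n)"
  by (auto simp: ultrafilter_nat_def principal_uf_def)

lemma mem_principal_uf [simp]: "A \<in> principal_uf n \<longleftrightarrow> n \<in> A"
  by (simp add: principal_uf_def)

lemma inj_principal_uf: "inj principal_uf"
proof (rule injI)
  fix m n assume "principal_uf m = principal_uf n"
  then have "{m} \<in> principal_uf n" using mem_principal_uf[of "{m}" m] by simp
  then show "m = n" by simp
qed

lemma singleton_mem_ultrafilter_iff:
  assumes "ultrafilter_nat U"
  shows "{n} \<in> U \<longleftrightarrow> U = principal_uf n"
proof
  assume "{n} \<in> U"
  then have "principal_uf n \<subseteq> U"
    using ultrafilter_nat_mono[OF assms] by (auto simp: principal_uf_def)
  then show "U = principal_uf n"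
    using ultrafilter_nat_subset_eq assms ultrafilter_principal_uf by blast
qed simp

lemma finite_mem_ultrafilterD:
  assumes "finite F" "ultrafilter_nat U" "F \<in> U"
  shows "U \<in> principal_uf ` F"
proof (rule ccontr)
  assume "U \<notin> principal_uf ` F"
  with assms(1) have "- F \<in> U"
  proof (induction F)
    case empty
    then show ?case using ultrafilter_nat_UNIV[OF assms(2)] by simp
  next
    case (insert n F)
    then have "- {n} \<in> U" "- F \<in> U"
      using singleton_mem_ultrafilter_iff[OF assms(2)] ultrafilter_nat_Compl_iff[OF assms(2)]
      by auto
    then have "- {n} \<inter> - F \<in> U"
      using ultrafilter_nat_Int[OF assms(2)] by blast
    moreover have "- {n} \<inter> - F = - insert n F" by blast
    ultimately show ?case by simp
  qed
  then show False
    using assms(3) ultrafilter_nat_Compl_iff[OF assms(2)] by blast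
qed

text \<open>The pushforward of \<open>p\<close> along \<open>f\<close>; in \<open>beta_omega\<close>
  it is the \<open>p\<close>-limit of the points \<open>principal_uf (f k)\<close>.\<close>

definition map_uf :: "(nat \<Rightarrow> nat) \<Rightarrow> nat set set \<Rightarrow> nat set set" where
  "map_uf f p = {B. f -` B \<in> p}"

lemma mem_map_uf: "B \<in> map_uf f p \<longleftrightarrow> {k. f k \<in> B} \<in> p"
  by (simp add: map_uf_def vimage_def)

lemma ultrafilter_map_uf:
  assumes "ultrafilter_nat p"
  shows "ultrafilter_nat (map_uf f p)"
  unfolding ultrafilter_nat_def map_uf_def
proof (intro conjI allI impI; (elim conjE)?; simp only: mem_Collect_eq)
  show "f -` {} \<notin> p" "f -` UNIV \<in> p"
    using ultrafilter_nat_empty[OF assms] ultrafilter_nat_UNIV[OF assms] by simp_all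
  show "f -` B \<in> p" if "f -` A \<in> p" "A \<subseteq> B" for A B
    using that ultrafilter_nat_mono[OF assms] by (meson vimage_mono)
  show "f -` (A \<inter> B) \<in> p" if "f -` A \<in> p" "f -` B \<in> p" for A B
    using that ultrafilter_nat_Int[OF assms] by (simp add: vimage_Int)
  show "f -` A \<in> p \<or> f -` (- A) \<in> p" for A
    using ultrafilter_nat_Compl_iff[OF assms] by (auto simp: vimage_Compl)
qed

lemma map_uf_omega_star:
  assumes "p \<in> omega_star" "inj f"
  shows "map_uf f p \<in> omega_star"
  using assms ultrafilter_map_uf[of p f] finite_vimageI[of _ f]
  by (auto simp: omega_star_def free_ultrafilter_nat_def map_uf_def)

lemma omega_star_cofinite:
  assumes "p \<in> omega_star" "finite (- A)"
  shows "A \<in> p"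
  using assms ultrafilter_nat_Compl_iff[of p A]
  by (auto simp: omega_star_def free_ultrafilter_nat_def)

lemma omega_star_ultrafilter: "p \<in> omega_star \<Longrightarrow> ultrafilter_nat p"
  by (simp add: omega_star_def free_ultrafilter_nat_def)

lemma omega_star_infinite: "p \<in> omega_star \<Longrightarrow> A \<in> p \<Longrightarrow> infinite A"
  by (auto simp: omega_star_def free_ultrafilter_nat_def)

text \<open>The ultrafilter lemma in the form that yields a free ultrafilter: since all members of
  \<open>\<S>\<close> are infinite, the cofinite sets can be added before Zorn's lemma is
  applied.\<close>

lemma ex_omega_star_superset:
  assumes "\<S> \<noteq> {}" and Int: "\<And>A B. A \<in> \<S> \<Longrightarrow> B \<in> \<S> \<Longrightarrow> A \<inter> B \<in> \<S>"
    and inf: "\<And>A. A \<in> \<S> \<Longrightarrow> infinite A"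
  obtains p where "p \<in> omega_star" "\<S> \<subseteq> p"
proof -
  \<comment> \<open>Allowing a finite error puts every cofinite set into \<open>F0\<close>, and
    \<open>{}\<close> stays out because members of \<open>\<S>\<close> are infinite.\<close>
  define F0 where "F0 = {A. \<exists>S\<in>\<S>. finite (S - A)}"
  define is_filter where "is_filter p \<longleftrightarrow> {} \<notin> p \<and> (\<forall>A B. A \<in> p \<and> A \<subseteq> B \<longrightarrow> B \<in> p) \<and>
     (\<forall>A B. A \<in> p \<and> B \<in> p \<longrightarrow> A \<inter> B \<in> p)" for p :: "nat set set"
  have F0: "is_filter F0"
    unfolding is_filter_def
  proof (intro conjI allI impI; (elim conjE)?)
    show "{} \<notin> F0" using inf by (auto simp: F0_def)
    show "B \<in> F0" if "A \<in> F0" "A \<subseteq> B" for A B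
      using that finite_subset[of "S - B" "S - A" for S] unfolding F0_def by blast
    show "A \<inter> B \<in> F0" if AB: "A \<in> F0" "B \<in> F0" for A B
    proof -
      obtain S T where "S \<in> \<S>" "T \<in> \<S>" "finite (S - A)" "finite (T - B)"
        using AB by (auto simp: F0_def)
      then show ?thesis
        using Int[of S T] finite_subset[of "S \<inter> T - A \<inter> B" "(S - A) \<union> (T - B)"]
        by (auto simp: F0_def)
    qed
  qed
  have "\<exists>M\<in>{p. F0 \<subseteq> p \<and> is_filter p}. \<forall>p\<in>{p. F0 \<subseteq> p \<and> is_filter p}. M \<subseteq> p \<longrightarrow> p = M"
  proof (rule subset_Zorn_nonempty)
    show "{p. F0 \<subseteq> p \<and> is_filter p} \<noteq> {}" using F0 by auto
    fix C assume C: "C \<noteq> {}" "subset.chain {p. F0 \<subseteq> p \<and> is_filter p} C"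
    have mem: "F0 \<subseteq> p" "is_filter p" if "p \<in> C" for p
      using C(2) that by (auto simp: subset.chain_def)
    have "is_filter (\<Union>C)"
      unfolding is_filter_def
    proof (intro conjI allI impI; (elim conjE)?)
      show "{} \<notin> \<Union>C" using mem by (auto simp: is_filter_def)
      show "B \<in> \<Union>C" if "A \<in> \<Union>C" "A \<subseteq> B" for A B
        using that mem unfolding is_filter_def by blast
      show "A \<inter> B \<in> \<Union>C" if AB: "A \<in> \<Union>C" "B \<in> \<Union>C" for A B
      proof -
        obtain p q where pq: "p \<in> C" "q \<in> C" "A \<in> p" "B \<in> q" using AB by auto
        then have "p \<subseteq> q \<or> q \<subseteq> p" using C(2) by (auto simp: subset_chain_def)
        then show ?thesis using pq mem unfolding is_filter_def by blast
      qed
    qed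
    then show "\<Union>C \<in> {p. F0 \<subseteq> p \<and> is_filter p}" using C(1) mem by auto
  qed
  then obtain M where M: "F0 \<subseteq> M" "is_filter M"
    and max: "\<And>p. F0 \<subseteq> p \<Longrightarrow> is_filter p \<Longrightarrow> M \<subseteq> p \<Longrightarrow> p = M" by auto
  have cof: "A \<in> M" if "finite (- A)" for A
    using that \<open>\<S> \<noteq> {}\<close> M(1) by (auto simp: F0_def Diff_eq)
  have "A \<in> M \<or> - A \<in> M" for A
  proof (rule ccontr)
    assume A: "\<not> (A \<in> M \<or> - A \<in> M)"
    \<comment> \<open>\<open>E\<close> is the filter generated by \<open>M\<close> and
      \<open>A\<close>. It is proper because \<open>- A\<close> is not in \<open>M\<close>, so it
      contradicts maximality.\<close>
    define E where "E = {C. \<exists>B\<in>M. B \<inter> A \<subseteq> C}"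
    have "M \<subseteq> E" by (auto simp: E_def)
    moreover have "A \<in> E" using cof[of UNIV] by (auto simp: E_def)
    moreover have "is_filter E"
      unfolding is_filter_def
    proof (intro conjI allI impI; (elim conjE)?)
      show "{} \<notin> E"
      proof
        assume "{} \<in> E"
        then obtain B where "B \<in> M" "B \<subseteq> - A" by (auto simp: E_def)
        then show False using A M(2) by (auto simp: is_filter_def)
      qed
      show "B \<in> E" if "C \<in> E" "C \<subseteq> B" for B C
        using that unfolding E_def by blast
      show "B \<inter> C \<in> E" if BC: "B \<in> E" "C \<in> E" for B C
      proof -
        obtain B' C' where "B' \<in> M" "C' \<in> M" "B' \<inter> A \<subseteq> B" "C' \<inter> A \<subseteq> C"
          using BC by (auto simp: E_def)
        then show ?thesis
          using M(2) unfolding E_def is_filter_def by (auto intro!: bexI[of _ "B' \<inter> C'"])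
      qed
    qed
    ultimately show False using max[of E] M(1) A by auto
  qed
  then have "ultrafilter_nat M"
    using M(2) cof[of UNIV] unfolding is_filter_def ultrafilter_nat_def by blast
  moreover have "A \<notin> M" if "finite A" for A
    using cof[of "- A"] that calculation ultrafilter_nat_Compl_iff by auto
  moreover have "\<S> \<subseteq> M"
    using M(1) unfolding F0_def
    by (metis (no_types, lifting) Diff_cancel finite.emptyI mem_Collect_eq subset_eq)
  ultimately show thesis
    using that by (auto simp: omega_star_def free_ultrafilter_nat_def)
qed

section \<open>Subspaces of the Stone-Cech compactification\<close>

lemma topspace_beta_omega: "topspace beta_omega = {U. ultrafilter_nat U}"
  unfolding beta_omega_def topology_generated_by_topspace
  using ultrafilter_nat_UNIV by blast

text \<open>The generating sets form a base: the sets given by \<open>A\<close> and \<open>B\<close>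
  intersect in the one given by \<open>A \<inter> B\<close>. So a single \<open>A\<close> describes
  a neighbourhood.\<close>

lemma openin_beta_omega_nbhd:
  assumes "openin beta_omega W" "q \<in> W"
  obtains A where "A \<in> q" "\<And>U. ultrafilter_nat U \<Longrightarrow> A \<in> U \<Longrightarrow> U \<in> W"
proof -
  have "ultrafilter_nat q"
    using assms openin_subset topspace_beta_omega by fastforce
  have "generate_topology_on {{U. ultrafilter_nat U \<and> A \<in> U} | A. True} W"
    using assms(1) unfolding beta_omega_def openin_topology_generated_by_iff .
  then have "\<exists>A\<in>q. \<forall>U. ultrafilter_nat U \<and> A \<in> U \<longrightarrow> U \<in> W"
    using \<open>q \<in> W\<close>
  proof (induction rule: generate_topology_on.induct)
    case (Int V W)
    then obtain A B where A: "A \<in> q" "\<forall>U. ultrafilter_nat U \<and> A \<in> U \<longrightarrow> U \<in> V"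
      and B: "B \<in> q" "\<forall>U. ultrafilter_nat U \<and> B \<in> U \<longrightarrow> U \<in> W" by auto
    have "U \<in> V \<inter> W" if "ultrafilter_nat U" "A \<inter> B \<in> U" for U
      using ultrafilter_nat_mono[OF that] A(2) B(2) that(1) by simp
    then show ?case
      using ultrafilter_nat_Int[OF \<open>ultrafilter_nat q\<close> A(1) B(1)] by blast
  next
    case (UN K)
    then show ?case by blast
  qed auto
  then show thesis using that by blast
qed

lemma openin_subtopology_beta_nbhd:
  assumes "openin (subtopology beta_omega X) W" "q \<in> W"
  obtains A where "A \<in> q" "\<And>U. U \<in> X \<Longrightarrow> ultrafilter_nat U \<Longrightarrow> A \<in> U \<Longrightarrow> U \<in> W"
proof -
  obtain S where S: "openin beta_omega S" "W = S \<inter> X"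
    using assms(1) by (auto simp: openin_subtopology)
  then obtain A where "A \<in> q" "\<And>U. ultrafilter_nat U \<Longrightarrow> A \<in> U \<Longrightarrow> U \<in> S"
    using openin_beta_omega_nbhd[of S q] assms(2) by blast
  then show thesis using that S(2) by blast
qed

lemma openin_subtopology_beta_basic:
  assumes "X \<subseteq> topspace beta_omega"
  shows "openin (subtopology beta_omega X) {U \<in> X. A \<in> U}"
proof -
  have "openin beta_omega {U. ultrafilter_nat U \<and> A \<in> U}"
    unfolding beta_omega_def by (rule topology_generated_by_Basis) blast
  moreover have "{U \<in> X. A \<in> U} = {U. ultrafilter_nat U \<and> A \<in> U} \<inter> X"
    using assms topspace_beta_omega by auto
  ultimately show ?thesis unfolding openin_subtopology by blast
qed

section \<open>The Vietoris topology\<close>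

lemma openin_vietoris_upper:
  "openin T U \<Longrightarrow> openin (vietoris T) {F \<in> CL T. F \<subseteq> U}"
  unfolding vietoris_def by (rule topology_generated_by_Basis) blast

lemma openin_vietoris_lower:
  "openin T U \<Longrightarrow> openin (vietoris T) {F \<in> CL T. F \<inter> U \<noteq> {}}"
  unfolding vietoris_def by (rule topology_generated_by_Basis) blast

lemma topspace_vietoris: "topspace (vietoris T) = CL T"
proof
  show "topspace (vietoris T) \<subseteq> CL T"
    unfolding vietoris_def topology_generated_by_topspace by blast
  have "{F \<in> CL T. F \<subseteq> topspace T} = CL T"
    by (auto simp: CL_def dest: closedin_subset)
  then show "CL T \<subseteq> topspace (vietoris T)"
    using openin_subset[OF openin_vietoris_upper[of T "topspace T"]] by simp
qed

text \<open>Basic Vietoris neighbourhoods: in a finite intersection of subbasic sets the containment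
  conditions merge into one \<open>U\<close>, while the hitting conditions accumulate in
  \<open>\<W>\<close>.\<close>

lemma openin_vietoris_nbhd:
  assumes "openin (vietoris T) V" "K \<in> V"
  obtains U \<W> where "openin T U" "K \<subseteq> U" "finite \<W>"
    "\<And>W. W \<in> \<W> \<Longrightarrow> openin T W \<and> K \<inter> W \<noteq> {}"
    "\<And>F. F \<in> CL T \<Longrightarrow> F \<subseteq> U \<Longrightarrow> (\<And>W. W \<in> \<W> \<Longrightarrow> F \<inter> W \<noteq> {}) \<Longrightarrow> F \<in> V"
proof -
  have "K \<in> CL T" using assms openin_subset topspace_vietoris by blast
  then have top: "K \<subseteq> topspace T" by (simp add: CL_def closedin_subset)
  have "generate_topology_on ({{F \<in> CL T. F \<subseteq> U} | U. openin T U} \<union>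
      {{F \<in> CL T. F \<inter> U \<noteq> {}} | U. openin T U}) V"
    using assms(1) unfolding vietoris_def openin_topology_generated_by_iff .
  then have "\<exists>U \<W>. openin T U \<and> K \<subseteq> U \<and> finite \<W> \<and> (\<forall>W\<in>\<W>. openin T W \<and> K \<inter> W \<noteq> {}) \<and>
    (\<forall>F\<in>CL T. F \<subseteq> U \<and> (\<forall>W\<in>\<W>. F \<inter> W \<noteq> {}) \<longrightarrow> F \<in> V)"
    using \<open>K \<in> V\<close>
  proof (induction rule: generate_topology_on.induct)
    case (Int V V')
    then have K: "K \<in> V" "K \<in> V'" by auto
    from Int.IH(1)[OF K(1)] obtain U \<W> where
      U: "openin T U" "K \<subseteq> U" "finite \<W>" "\<forall>W\<in>\<W>. openin T W \<and> K \<inter> W \<noteq> {}"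
       "\<forall>F\<in>CL T. F \<subseteq> U \<and> (\<forall>W\<in>\<W>. F \<inter> W \<noteq> {}) \<longrightarrow> F \<in> V" by (elim exE conjE)
    from Int.IH(2)[OF K(2)] obtain U' \<W>' where
      U': "openin T U'" "K \<subseteq> U'" "finite \<W>'" "\<forall>W\<in>\<W>'. openin T W \<and> K \<inter> W \<noteq> {}"
       "\<forall>F\<in>CL T. F \<subseteq> U' \<and> (\<forall>W\<in>\<W>'. F \<inter> W \<noteq> {}) \<longrightarrow> F \<in> V'" by (elim exE conjE)
    have "F \<in> V \<inter> V'" if "F \<in> CL T" "F \<subseteq> U \<inter> U'" "\<forall>W\<in>\<W> \<union> \<W>'. F \<inter> W \<noteq> {}" for F
      using that U(5) U'(5) by simp
    moreover have "openin T (U \<inter> U') \<and> K \<subseteq> U \<inter> U' \<and> finite (\<W> \<union> \<W>') \<and>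
        (\<forall>W\<in>\<W> \<union> \<W>'. openin T W \<and> K \<inter> W \<noteq> {})"
      using U(1-4) U'(1-4) by (simp add: openin_Int ball_Un)
    ultimately show ?case
      by (intro exI[of _ "U \<inter> U'"] exI[of _ "\<W> \<union> \<W>'"]) simp
  next
    case (UN \<K>)
    then obtain V where "V \<in> \<K>" "K \<in> V" by blast
    from UN.IH[OF this] obtain U \<W> where U: "openin T U" "K \<subseteq> U" "finite \<W>"
      "\<forall>W\<in>\<W>. openin T W \<and> K \<inter> W \<noteq> {}"
      "\<forall>F\<in>CL T. F \<subseteq> U \<and> (\<forall>W\<in>\<W>. F \<inter> W \<noteq> {}) \<longrightarrow> F \<in> V" by (elim exE conjE)
    have "F \<in> \<Union>\<K>" if "F \<in> CL T" "F \<subseteq> U" "\<forall>W\<in>\<W>. F \<inter> W \<noteq> {}" for F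
      using that U(5) \<open>V \<in> \<K>\<close> by auto
    with U(1-4) show ?case by (intro exI[of _ U] exI[of _ \<W>]) simp
  next
    case (Basis S)
    then consider U where "openin T U" "S = {F \<in> CL T. F \<subseteq> U}"
      | W where "openin T W" "S = {F \<in> CL T. F \<inter> W \<noteq> {}}" by blast
    then show ?case
    proof cases
      case 1
      then show ?thesis using Basis by (intro exI[of _ U] exI[of _ "{}"]) auto
    next
      case 2
      then show ?thesis using Basis top
        by (intro exI[of _ "topspace T"] exI[of _ "{W}"]) auto
    qed
  qed simp
  then show thesis
    by (elim exE conjE) (rule that, auto)
qed

section \<open>Hyperspaces of spaces between omega and its compactification\<close>

locale omega_extension =
  fixes X :: "nat set set set"
  assumes omega_subset: "range principal_uf \<subseteq> X"
    and subset_beta: "X \<subseteq> topspace beta_omega"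
begin

abbreviation "T \<equiv> subtopology beta_omega X"

lemma topspace_T: "topspace T = X"
  using subset_beta by (simp add: inf_absorb2)

lemma ultrafilter_of_mem: "q \<in> X \<Longrightarrow> ultrafilter_nat q"
  using subset_beta topspace_beta_omega by auto

lemma principal_mem: "principal_uf n \<in> X"
  using omega_subset by auto

lemmas openin_basic = openin_subtopology_beta_basic[OF subset_beta]

lemma nbhd:
  assumes "openin T W" "q \<in> W"
  obtains A where "A \<in> q" "\<And>U. U \<in> X \<Longrightarrow> A \<in> U \<Longrightarrow> U \<in> W"
  using openin_subtopology_beta_nbhd[OF assms] ultrafilter_of_mem by metis

lemma mem_principal_image_iff:
  assumes "finite F" "q \<in> X"
  shows "q \<in> principal_uf ` F \<longleftrightarrow> F \<in> q"
  using finite_mem_ultrafilterD[OF assms(1) ultrafilter_of_mem[OF assms(2)]] by auto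

lemma openin_principal_image:
  assumes "finite F"
  shows "openin T (principal_uf ` F)"
proof -
  have "principal_uf ` F = {q \<in> X. F \<in> q}"
    using mem_principal_image_iff[OF assms] principal_mem by auto
  then show ?thesis using openin_basic by simp
qed

lemma openin_Diff_principal_image:
  assumes "finite F"
  shows "openin T (X - principal_uf ` F)"
proof -
  have "X - principal_uf ` F = {q \<in> X. - F \<in> q}"
    using mem_principal_image_iff[OF assms] ultrafilter_nat_Compl_iff ultrafilter_of_mem by auto
  then show ?thesis using openin_basic by simp
qed

lemma CL_subset: "K \<in> CL T \<Longrightarrow> K \<subseteq> X"
  using closedin_subset topspace_T unfolding CL_def by blast

lemma principal_image_CL:
  assumes "finite F" "F \<noteq> {}"
  shows "principal_uf ` F \<in> CL T"
  using assms openin_Diff_principal_image principal_mem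
  by (auto simp: CL_def closedin_def topspace_T simp del: topspace_subtopology)

text \<open>Points of \<omega> are isolated in \<open>X\<close>, so lying inside the image of
  \<open>F\<close> and hitting each of its points is an open condition that leaves one set
  only.\<close>

lemma openin_vietoris_finite:
  assumes "finite F" "F \<noteq> {}"
  shows "openin (vietoris T) {principal_uf ` F}"
proof -
  have eq: "{principal_uf ` F} = {K \<in> CL T. K \<subseteq> principal_uf ` F} \<inter>
        (\<Inter>n\<in>F. {K \<in> CL T. K \<inter> principal_uf ` {n} \<noteq> {}})" (is "_ = ?R")
  proof
    show "{principal_uf ` F} \<subseteq> ?R" using principal_image_CL[OF assms] by auto
    show "?R \<subseteq> {principal_uf ` F}" by fastforce
  qed
  show ?thesis
    unfolding eq using assms
    by (intro openin_Int openin_INT2 openin_vietoris_upper openin_vietoris_lower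
        openin_principal_image) auto
qed

text \<open>Any other \<open>K\<close> either has a point outside the image of \<open>F\<close> or
  misses some \<open>n\<close> in \<open>F\<close>; both conditions are open.\<close>

lemma closedin_vietoris_finite:
  assumes "finite F" "F \<noteq> {}"
  shows "closedin (vietoris T) {principal_uf ` F}"
proof -
  have eq: "CL T - {principal_uf ` F} = {K \<in> CL T. K \<inter> (X - principal_uf ` F) \<noteq> {}} \<union>
      (\<Union>n\<in>F. {K \<in> CL T. K \<subseteq> X - principal_uf ` {n}})" (is "?L = ?R")
  proof
    show "?R \<subseteq> ?L" by auto
    show "?L \<subseteq> ?R"
    proof
      fix K assume K: "K \<in> ?L"
      then have "K \<subseteq> X" using CL_subset by blast
      with K show "K \<in> ?R" by auto
    qed
  qed
  have "openin (vietoris T) ?R"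
    using assms by (intro openin_Un openin_Union)
      (auto intro!: openin_vietoris_lower openin_vietoris_upper openin_Diff_principal_image
        openin_Diff_principal_image[of "{_}", simplified])
  then show ?thesis
    using principal_image_CL[OF assms] by (simp add: closedin_def topspace_vietoris eq)
qed

text \<open>Density of the finite subsets of \<omega>: inside a basic neighbourhood, choose one
  natural number from each \<open>W \<inter> U\<close>.\<close>

lemma openin_vietoris_finite_mem:
  assumes "openin (vietoris T) V" "V \<noteq> {}"
  obtains F where "finite F" "F \<noteq> {}" "principal_uf ` F \<in> V"
proof -
  obtain K where "K \<in> V" using assms by blast
  then obtain U \<W> where U: "openin T U" "K \<subseteq> U" "finite \<W>"
    and \<W>: "\<And>W. W \<in> \<W> \<Longrightarrow> openin T W \<and> K \<inter> W \<noteq> {}"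
    and V: "\<And>F. F \<in> CL T \<Longrightarrow> F \<subseteq> U \<Longrightarrow> (\<And>W. W \<in> \<W> \<Longrightarrow> F \<inter> W \<noteq> {}) \<Longrightarrow> F \<in> V"
    using openin_vietoris_nbhd[OF assms(1)] by metis
  have "K \<in> CL T" using assms openin_subset topspace_vietoris \<open>K \<in> V\<close> by blast
  then have KX: "K \<noteq> {}" "K \<subseteq> X"
    using CL_subset by (auto simp: CL_def)
  have ex: "\<exists>n. principal_uf n \<in> W \<inter> U" if W: "openin T W" "K \<inter> W \<noteq> {}" for W
  proof -
    obtain q where q: "q \<in> K" "q \<in> W \<inter> U" using W U by blast
    obtain A where A: "A \<in> q" "\<And>p. p \<in> X \<Longrightarrow> A \<in> p \<Longrightarrow> p \<in> W \<inter> U"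
      using nbhd[OF openin_Int[OF W(1) U(1)] q(2)] by blast
    have "A \<noteq> {}"
      using A q KX ultrafilter_of_mem ultrafilter_nat_empty by blast
    then show ?thesis using A(2)[OF principal_mem] by auto
  qed
  \<comment> \<open>\<open>X\<close> is added to \<open>\<W>\<close> so that the finite set chosen
    is nonempty even if \<open>\<W>\<close> is empty.\<close>
  have "\<exists>c. \<forall>W\<in>insert X \<W>. principal_uf (c W) \<in> W \<inter> U"
    using ex \<W> openin_topspace[of T] KX unfolding topspace_T
    by (intro bchoice) (metis inf.absorb1 insert_iff)
  then obtain c where c: "\<And>W. W \<in> insert X \<W> \<Longrightarrow> principal_uf (c W) \<in> W \<inter> U" by blast
  let ?F = "c ` insert X \<W>"
  have "principal_uf ` ?F \<in> V"
  proof (rule V)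
    show "principal_uf ` ?F \<in> CL T" using U by (intro principal_image_CL) auto
  qed (use c in auto)
  then show thesis using that[of ?F] U by auto
qed

section \<open>Consequences of pseudocompactness of the hyperspace\<close>

text \<open>Without an accumulation point, the isolated points given by the \<open>G k\<close> form
  a clopen discrete set, and the function that is \<open>k\<close> at the \<open>k\<close>-th point
  and 0 elsewhere is continuous and unbounded.\<close>

lemma pseudocompact_accumulation:
  assumes pc: "pseudocompact (vietoris T)" and fin: "\<And>k. finite (G k)" "\<And>k. G k \<noteq> {}"
    and inj: "inj G"
  shows "\<exists>K\<in>CL T. \<forall>V. openin (vietoris T) V \<and> K \<in> V \<longrightarrow>
    infinite {k::nat. principal_uf ` G k \<in> V}"
proof (rule ccontr)
  assume neg: "\<not> ?thesis"
  define P where "P k = principal_uf ` G k" for k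
  have "inj P"
    using inj inj_image_eq_iff[OF inj_principal_uf] by (auto simp: P_def inj_def)
  have opn: "openin (vietoris T) {P k}" and cls: "closedin (vietoris T) {P k}" for k
    using openin_vietoris_finite closedin_vietoris_finite fin by (auto simp: P_def)
  have nb: "\<exists>V. openin (vietoris T) V \<and> K \<in> V \<and> finite {k. P k \<in> V}" if "K \<in> CL T" for K
    using neg that unfolding P_def by blast
  have opM: "openin (vietoris T) (P ` M)" for M
  proof -
    have "openin (vietoris T) (\<Union>k\<in>M. {P k})" using opn by blast
    then show ?thesis by (simp add: UNION_singleton_eq_range)
  qed
  have clM: "closedin (vietoris T) (P ` M)" for M
    unfolding closedin_def
  proof
    show "P ` M \<subseteq> topspace (vietoris T)" using opM openin_subset by blast
    show "openin (vietoris T) (topspace (vietoris T) - P ` M)"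
    proof (subst openin_subopen, intro ballI)
      fix K assume K: "K \<in> topspace (vietoris T) - P ` M"
      then obtain V where V: "openin (vietoris T) V" "K \<in> V" "finite {k. P k \<in> V}"
        using nb[of K] unfolding topspace_vietoris by blast
      \<comment> \<open>The neighbourhood \<open>V\<close> of \<open>K\<close> contains only
        finitely many of the points \<open>P k\<close>; those with \<open>k\<close> in
        \<open>M\<close> differ from \<open>K\<close> and can be removed from it.\<close>
      have "closedin (vietoris T) (\<Union>k\<in>{k \<in> M. P k \<in> V}. {P k})"
        using V(3) cls by (intro closedin_Union) auto
      then have "openin (vietoris T) (V - (\<Union>k\<in>{k \<in> M. P k \<in> V}. {P k}))"
        using V(1) by (simp add: openin_diff)
      moreover have "V \<subseteq> topspace (vietoris T)" using V openin_subset by blast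
      ultimately show "\<exists>V. openin (vietoris T) V \<and> K \<in> V \<and> V \<subseteq> topspace (vietoris T) - P ` M"
        using K V by (intro exI conjI) (assumption, auto)
    qed
  qed
  define h where "h K = (if K \<in> range P then real (inv P K) else 0)" for K
  have hP: "h (P k) = real k" for k
    using \<open>inj P\<close> by (simp add: h_def)
  have "continuous_map (vietoris T) euclideanreal h"
    unfolding continuous_map_def
  proof (intro conjI allI impI)
    fix S :: "real set"
    show "openin (vietoris T) {K \<in> topspace (vietoris T). h K \<in> S}"
    \<comment> \<open>Off the sequence \<open>h\<close> is 0, so the preimage of \<open>S\<close> is
      either the complement of a subset of \<open>range P\<close> or such a subset itself.\<close>
    proof (cases "0 \<in> S")
      case True
      have "{K \<in> topspace (vietoris T). h K \<in> S} = topspace (vietoris T) - P ` {k. real k \<notin> S}"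
        using True hP by (auto simp: h_def inj_image_mem_iff[OF \<open>inj P\<close>])
      then show ?thesis using clM by auto
    next
      case False
      have "{K \<in> topspace (vietoris T). h K \<in> S} = P ` {k. real k \<in> S}"
        using False hP openin_subset[OF opn] by (auto simp: h_def inv_f_f[OF \<open>inj P\<close>])
      then show ?thesis using opM by auto
    qed
  qed simp
  then have "bounded (h ` topspace (vietoris T))" using pc by (simp add: pseudocompact_def)
  then obtain b where "\<And>K. K \<in> topspace (vietoris T) \<Longrightarrow> \<bar>h K\<bar> \<le> b"
    unfolding bounded_iff by auto
  then have "real k \<le> b" for k
    using openin_subset[OF opn[of k]] hP[of k] by fastforce
  then show False using reals_Archimedean2[of b] by (meson not_le)
qed

text \<open>Along a suitable \<open>p\<close> the sets \<open>G k\<close> converge to some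
  \<open>K\<close>. By disjointness a selector's range meets each \<open>G k\<close> in one point,
  which forces \<open>K\<close> to contain the pushforward. The same \<open>p\<close> serves all
  selectors.\<close>

lemma map_uf_selector_mem:
  assumes pc: "pseudocompact (vietoris T)" and fin: "\<And>k::nat. finite (G k)" "\<And>k. G k \<noteq> {}"
    and disj: "\<And>k l. k \<noteq> l \<Longrightarrow> G k \<inter> G l = {}"
  shows "\<exists>p\<in>omega_star. \<forall>f. (\<forall>k. f k \<in> G k) \<longrightarrow> map_uf f p \<in> X"
proof -
  have "inj G" using disj fin by (intro injI) (metis inf.idem)
  then obtain K where K: "K \<in> CL T" and
    acc: "\<And>V. openin (vietoris T) V \<Longrightarrow> K \<in> V \<Longrightarrow> infinite {k. principal_uf ` G k \<in> V}"
    using pseudocompact_accumulation[of G, OF pc fin] by blast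
  \<comment> \<open>The traces of the neighbourhoods of \<open>K\<close> on the indices; a free
    ultrafilter containing them all makes \<open>K\<close> a \<open>p\<close>-limit.\<close>
  define \<S> where "\<S> = {{k. principal_uf ` G k \<in> V} |V. openin (vietoris T) V \<and> K \<in> V}"
  obtain p where p: "p \<in> omega_star" "\<S> \<subseteq> p"
  proof (rule ex_omega_star_superset[of \<S>])
    show "\<S> \<noteq> {}" 
      using K openin_topspace[of "vietoris T"] unfolding \<S>_def topspace_vietoris by blast
    show "A \<inter> B \<in> \<S>" if AB: "A \<in> \<S>" "B \<in> \<S>" for A B
    proof -
      obtain V W where "openin (vietoris T) V" "K \<in> V" "A = {k. principal_uf ` G k \<in> V}"
        "openin (vietoris T) W" "K \<in> W" "B = {k. principal_uf ` G k \<in> W}"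
        using AB unfolding \<S>_def by blast
      then show ?thesis unfolding \<S>_def
        by (intro CollectI exI[of _ "V \<inter> W"]) auto
    qed
    show "infinite A" if "A \<in> \<S>" for A using that acc by (auto simp: \<S>_def)
  qed
  note up = omega_star_ultrafilter[OF p(1)]
  have lim: "{k. principal_uf ` G k \<in> V} \<in> p" if "openin (vietoris T) V" "K \<in> V" for V
    using that p(2) by (auto simp: \<S>_def)
  have KX: "K \<subseteq> X" using K CL_subset by blast
  have "map_uf f p \<in> X" if f: "\<forall>k. f k \<in> G k" for f
  proof -
    \<comment> \<open>Otherwise \<open>K\<close> lies in the open set of ultrafilters containing
      \<open>- range f\<close>, and then so does the image of some \<open>G k\<close>, although it
      contains \<open>principal_uf (f k)\<close>.\<close>
    have "\<exists>q\<in>K. range f \<in> q"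
    proof (rule ccontr)
      assume "\<not> ?thesis"
      then have "K \<subseteq> {q \<in> X. - range f \<in> q}"
        using KX ultrafilter_nat_Compl_iff[OF ultrafilter_of_mem, of _ "range f"] by auto
      then have "{k. principal_uf ` G k \<in> {F \<in> CL T. F \<subseteq> {q \<in> X. - range f \<in> q}}} \<in> p"
        using K by (intro lim openin_vietoris_upper openin_basic) auto
      then have "{k. principal_uf ` G k \<in> {F \<in> CL T. F \<subseteq> {q \<in> X. - range f \<in> q}}} \<noteq> {}"
        using ultrafilter_nat_empty[OF up] by metis
      then obtain k where "principal_uf ` G k \<subseteq> {q \<in> X. - range f \<in> q}" by auto
      then have "principal_uf (f k) \<in> {q \<in> X. - range f \<in> q}" using f by blast
      then show False by simp
    qed
    then obtain q where q: "q \<in> K" "range f \<in> q" by blast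
    have uq: "ultrafilter_nat q" using q KX ultrafilter_of_mem by blast
    have "q \<subseteq> map_uf f p"
    proof
      fix B assume "B \<in> q"
      \<comment> \<open>Passing to \<open>range f \<inter> B\<close> matters: a point of
        \<open>G k\<close> in this set can only be \<open>f k\<close>.\<close>
      then have "range f \<inter> B \<in> q" using q ultrafilter_nat_Int[OF uq] by blast
      then have "{k. principal_uf ` G k \<in> {F \<in> CL T. F \<inter> {q \<in> X. range f \<inter> B \<in> q} \<noteq> {}}} \<in> p"
        using K q KX by (intro lim openin_vietoris_lower openin_basic) auto
      then have "{k. f k \<in> B} \<in> p"
      proof (rule ultrafilter_nat_mono[OF up], intro subsetI CollectI)
        fix k
        assume "k \<in> {k. principal_uf ` G k \<in>
            {F \<in> CL T. F \<inter> {q \<in> X. range f \<inter> B \<in> q} \<noteq> {}}}"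
        then obtain x where "x \<in> G k" "range f \<inter> B \<in> principal_uf x" by blast
        then obtain l where "x = f l" "x \<in> B" by auto
        then show "f k \<in> B" using disj[of k l] spec[OF f, of l] \<open>x \<in> G k\<close> by auto
      qed
      then show "B \<in> map_uf f p" by (simp add: mem_map_uf)
    qed
    then have "q = map_uf f p"
      using ultrafilter_nat_subset_eq uq ultrafilter_map_uf[OF up] by blast
    then show ?thesis using q KX by auto
  qed
  then show ?thesis using p(1) by blast
qed

text \<open>As \<open>X\<close> need not be compact, the candidate limit has to be shown dense
  in the \<open>p\<close>-limit taken in the compact space of all ultrafilters; this is the hypothesis on \<open>A\<close>.\<close>

lemma ex_p_limit_finite:
  assumes up: "ultrafilter_nat p" and fin: "\<And>n. finite (F n)" "\<And>n. F n \<noteq> {}"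
    and dense: "\<And>A. {n. F n \<inter> A \<noteq> {}} \<in> p \<Longrightarrow>
      \<exists>q\<in>X. A \<in> q \<and> (\<forall>B\<in>q. {n. F n \<inter> B \<noteq> {}} \<in> p)"
  shows "\<exists>K. p_limit (vietoris T) p (\<lambda>n. {principal_uf ` F n}) K"
proof -
  \<comment> \<open>\<open>K\<close> is the trace on \<open>X\<close> of the \<open>p\<close>-limit
    formed in \<open>beta_omega\<close>.\<close>
  define K where "K = {q \<in> X. \<forall>B\<in>q. {n. F n \<inter> B \<noteq> {}} \<in> p}"
  have "K \<noteq> {}"
    using dense[of UNIV] fin ultrafilter_nat_UNIV[OF up] by (auto simp: K_def)
  moreover have "closedin T K"
    unfolding closedin_def topspace_T
  proof
    have "X - K = (\<Union>B\<in>{B. {n. F n \<inter> B \<noteq> {}} \<notin> p}. {q \<in> X. B \<in> q})"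
      by (auto simp: K_def)
    then show "openin T (X - K)" using openin_basic by auto
  qed (auto simp: K_def)
  ultimately have K: "K \<in> CL T" by (simp add: CL_def)
  have hits: "{n. principal_uf ` F n \<inter> W \<noteq> {}} \<in> p" if W: "openin T W" "K \<inter> W \<noteq> {}" for W
  proof -
    obtain q where q: "q \<in> K" "q \<in> W" using W by blast
    then obtain A where A: "A \<in> q" "\<And>u. u \<in> X \<Longrightarrow> A \<in> u \<Longrightarrow> u \<in> W"
      using nbhd[OF W(1)] by metis
    then have "{n. F n \<inter> A \<noteq> {}} \<in> p" using q by (auto simp: K_def)
    then show ?thesis
      by (rule ultrafilter_nat_mono[OF up]) (use A(2)[OF principal_mem] in auto)
  qed
  have sub: "{n. principal_uf ` F n \<subseteq> U} \<in> p" if U: "openin T U" "K \<subseteq> U" for U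
  proof (rule ccontr)
    \<comment> \<open>If the sets leave \<open>U\<close> for \<open>p\<close>-many \<open>n\<close>,
      they meet \<open>?A\<close>, so \<open>dense\<close> gives a point of \<open>K\<close>
      containing \<open>?A\<close>. As a point of \<open>U\<close> it also contains a set disjoint
      from \<open>?A\<close>.\<close>
    let ?A = "{n. principal_uf n \<notin> U}"
    assume "{n. principal_uf ` F n \<subseteq> U} \<notin> p"
    then have "- {n. principal_uf ` F n \<subseteq> U} \<in> p"
      using ultrafilter_nat_Compl_iff[OF up] by blast
    then have "{n. F n \<inter> ?A \<noteq> {}} \<in> p"
      by (rule ultrafilter_nat_mono[OF up]) auto
    then obtain q where q: "q \<in> X" "?A \<in> q" "q \<in> K"
      using dense[of ?A] by (auto simp: K_def)
    then obtain B where B: "B \<in> q" "\<And>u. u \<in> X \<Longrightarrow> B \<in> u \<Longrightarrow> u \<in> U"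
      using nbhd[OF U(1)] U(2) by (metis subsetD)
    have "?A \<inter> B = {}" using B(2) principal_mem by auto
    moreover have "ultrafilter_nat q" using q ultrafilter_of_mem by blast
    ultimately show False
      using ultrafilter_nat_Int[of q ?A B] ultrafilter_nat_empty[of q] q B by auto
  qed
  have "p_limit (vietoris T) p (\<lambda>n. {principal_uf ` F n}) K"
    unfolding p_limit_def
  proof (intro conjI allI impI; (elim conjE)?)
    show "K \<in> topspace (vietoris T)" using K topspace_vietoris by blast
    fix V assume "openin (vietoris T) V" "K \<in> V"
    then obtain U \<W> where U: "openin T U" "K \<subseteq> U" "finite \<W>"
      and \<W>: "\<And>W. W \<in> \<W> \<Longrightarrow> openin T W \<and> K \<inter> W \<noteq> {}"
      and V: "\<And>F. F \<in> CL T \<Longrightarrow> F \<subseteq> U \<Longrightarrow> (\<And>W. W \<in> \<W> \<Longrightarrow> F \<inter> W \<noteq> {}) \<Longrightarrow> F \<in> V"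
      using openin_vietoris_nbhd[of T V K] by metis
    have "{n. \<forall>W\<in>\<W>. principal_uf ` F n \<inter> W \<noteq> {}} \<in> p"
      using U(3) \<W>
    proof (induction \<W>)
      case empty
      then show ?case using ultrafilter_nat_UNIV[OF up] by simp
    next
      case (insert W \<W>)
      then show ?case
        using hits[of W] ultrafilter_nat_Int[OF up, of "{n. principal_uf ` F n \<inter> W \<noteq> {}}"]
        by (simp add: Collect_conj_eq)
    qed
    then have "{n. \<forall>W\<in>\<W>. principal_uf ` F n \<inter> W \<noteq> {}} \<inter> {n. principal_uf ` F n \<subseteq> U} \<in> p"
      using sub[OF U(1,2)] ultrafilter_nat_Int[OF up] by blast
    then show "{n. V \<inter> {principal_uf ` F n} \<noteq> {}} \<in> p"
      by (rule ultrafilter_nat_mono[OF up]) (use V principal_image_CL[OF fin] in auto)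
  qed
  then show ?thesis by blast
qed

end

section \<open>Thinning out fewer than h sequences simultaneously\<close>

text \<open>For \<open>b\<close> in \<open>A\<close> past the threshold, with neighbours in
  \<open>A\<close>, the set \<open>F b\<close> is an initial piece of a fixed \<open>R\<close> up to
  the predecessor of \<open>b\<close>, plus a part ending before the successor. The threshold
  \<open>m\<close> makes the property survive finite changes of \<open>A\<close>.\<close>

definition splits_along :: "(nat \<Rightarrow> nat set) \<Rightarrow> nat set \<Rightarrow> bool" where
  "splits_along F A \<longleftrightarrow> (\<exists>R m. \<forall>a\<in>A. \<forall>b\<in>A. m \<le> a \<and> a < b \<longrightarrow>
     F a \<subseteq> {..<b} \<and> F b \<inter> {..<a} = R \<inter> {..<a})"

text \<open>A free ultrafilter containing \<open>A\<close> determines a pointwise limit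
  \<open>R\<close> of the sets \<open>F n\<close>; a recursive choice inside \<open>A\<close> then
  keeps to indices that agree with \<open>R\<close> far enough and exceed the preceding set.\<close>

lemma splits_along_dense:
  assumes fin: "\<And>n. finite (F n)" and "infinite A"
  shows "\<exists>B\<subseteq>A. infinite B \<and> splits_along F B"
proof -
  obtain u where u: "u \<in> omega_star" "{A} \<subseteq> u"
    using ex_omega_star_superset[of "{A}"] \<open>infinite A\<close> by auto
  note uu = omega_star_ultrafilter[OF u(1)]
  define R where "R = {x. {n. x \<in> F n} \<in> u}"
  have eq: "{n. F n \<inter> {..<a} = R \<inter> {..<a}} \<in> u" for a
  proof (induction a)
    case 0
    then show ?case using ultrafilter_nat_UNIV[OF uu] by simp
  next
    case (Suc a)
    have "{n. a \<in> F n \<longleftrightarrow> a \<in> R} \<in> u"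
    proof (cases "a \<in> R")
      case True
      then show ?thesis by (simp add: R_def)
    next
      case False
      then show ?thesis
        using ultrafilter_nat_Compl_iff[OF uu, of "{n. a \<in> F n}"] by (simp add: R_def Collect_neg_eq)
    qed
    then have "{n. F n \<inter> {..<a} = R \<inter> {..<a}} \<inter> {n. a \<in> F n \<longleftrightarrow> a \<in> R} \<in> u"
      using Suc ultrafilter_nat_Int[OF uu] by blast
    then show ?case
      by (rule ultrafilter_nat_mono[OF uu]) (auto simp: lessThan_Suc)
  qed
  have "\<exists>b. \<forall>k. b k \<in> A \<and> b k < b (Suc k) \<and> F (b k) \<subseteq> {..<b (Suc k)} \<and>
      F (b (Suc k)) \<inter> {..<b k} = R \<inter> {..<b k}"
  proof (rule dependent_nat_choice[where P = "\<lambda>_ x. x \<in> A" and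
        Q = "\<lambda>_ x y. x < y \<and> F x \<subseteq> {..<y} \<and> F y \<inter> {..<x} = R \<inter> {..<x}"])
    show "\<exists>x. x \<in> A" using \<open>infinite A\<close> by (metis finite.emptyI ex_in_conv)
    fix x
    obtain c where c: "F x \<subseteq> {..<c}" using fin[of x] finite_nat_iff_bounded by blast
    have "A \<inter> {n. F n \<inter> {..<x} = R \<inter> {..<x}} \<in> u"
      using u eq ultrafilter_nat_Int[OF uu] by blast
    then have "infinite (A \<inter> {n. F n \<inter> {..<x} = R \<inter> {..<x}})"
      using omega_star_infinite u by blast
    then obtain y where "y > max x c" "y \<in> A" "F y \<inter> {..<x} = R \<inter> {..<x}"
      unfolding infinite_nat_iff_unbounded by blast
    then show "\<exists>y. y \<in> A \<and> x < y \<and> F x \<subseteq> {..<y} \<and> F y \<inter> {..<x} = R \<inter> {..<x}"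
      using c by (intro exI[of _ y]) force
  qed
  then obtain b where b: "\<And>k. b k \<in> A" "\<And>k. b k < b (Suc k)" "\<And>k. F (b k) \<subseteq> {..<b (Suc k)}"
    "\<And>k. F (b (Suc k)) \<inter> {..<b k} = R \<inter> {..<b k}" by blast
  have mono: "strict_mono b" using b(2) by (simp add: strict_mono_Suc_iff)
  \<comment> \<open>The conditions on consecutive terms extend to all pairs because \<open>b\<close>
    is increasing.\<close>
  have "F (b i) \<subseteq> {..<b j} \<and> F (b j) \<inter> {..<b i} = R \<inter> {..<b i}" if "b i < b j" for i j
  proof -
    have "i < j" using that mono by (simp add: strict_mono_less)
    then obtain j' where j: "j = Suc j'" "i \<le> j'" by (cases j) auto
    have "b (Suc i) \<le> b j" "b i \<le> b j'"
      using j mono by (auto simp: strict_mono_less_eq)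
    then show ?thesis using b(3)[of i] b(4)[of j'] j by force
  qed
  then have "splits_along F (range b)"
    unfolding splits_along_def by (intro exI[of _ R]) auto
  moreover have "infinite (range b)"
    using mono strict_mono_imp_inj_on range_inj_infinite by blast
  ultimately show ?thesis using b(1) by blast
qed

text \<open>Closure under almost inclusion holds by raising the threshold above the finite set
  \<open>C - B\<close>.\<close>

lemma open_dense_splits_along:
  assumes "\<And>n. finite (F n)"
  shows "open_dense_inf {A. infinite A \<and> splits_along F A}"
  unfolding open_dense_inf_def
proof (intro conjI ballI allI impI; (elim conjE)?)
  show "\<exists>B\<in>{A. infinite A \<and> splits_along F A}. B \<subseteq> A" if "infinite A" for A
    using splits_along_dense[of F A, OF assms that] by blast
  fix B C assume B: "B \<in> {A. infinite A \<and> splits_along F A}" and C: "infinite C" "finite (C - B)"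
  from B have "splits_along F B" by simp
  then obtain R m where Rm: "\<forall>a\<in>B. \<forall>b\<in>B. m \<le> a \<and> a < b \<longrightarrow>
     F a \<subseteq> {..<b} \<and> F b \<inter> {..<a} = R \<inter> {..<a}"
    unfolding splits_along_def by (elim exE)
  obtain c where c: "C - B \<subseteq> {..<c}" using C(2) finite_nat_iff_bounded by blast
  have "a \<in> B" if "a \<in> C" "c \<le> a" for a using c that by force
  then have "\<forall>a\<in>C. \<forall>b\<in>C. max m c \<le> a \<and> a < b \<longrightarrow>
     F a \<subseteq> {..<b} \<and> F b \<inter> {..<a} = R \<inter> {..<a}"
    using Rm by simp
  then have "splits_along F C" unfolding splits_along_def by blast
  then show "C \<in> {A. infinite A \<and> splits_along F A}" using C by simp
qed simp

lemma less_than_h_common: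
  fixes I :: "'i set"
  assumes "less_than_h I" and "\<And>i. i \<in> I \<Longrightarrow> open_dense_inf (D i)"
  shows "\<exists>A. infinite A \<and> (\<forall>i\<in>I. A \<in> D i)"
proof -
  have "(card_of I, card_of (D ` I)) \<notin> ordLess"
    using card_of_image not_ordLess_ordLeq by blast
  moreover have "(\<forall>E\<in>D ` I. open_dense_inf E) \<and> {A. infinite A \<and> (\<forall>E\<in>D ` I. A \<in> E)} = {}
      \<longrightarrow> (card_of I, card_of (D ` I)) \<in> ordLess"
    using assms(1) unfolding less_than_h_def by (rule spec)
  moreover have "\<forall>E\<in>D ` I. open_dense_inf E" using assms(2) by blast
  ultimately have "{A. infinite A \<and> (\<forall>E\<in>D ` I. A \<in> E)} \<noteq> {}" by blast
  then show ?thesis by blast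
qed

section \<open>One ultrafilter for all the given sequences\<close>

theorem theorem4p9:
  fixes X :: "nat set set set" and I :: "'i set"
  assumes "range principal_uf \<subseteq> X"
    and "X \<subseteq> topspace beta_omega"
    and "pseudocompact (vietoris (subtopology beta_omega X))"
    and "less_than_h I"
  shows "kappa_omega_star_pseudocompact I (vietoris (subtopology beta_omega X))"
  unfolding kappa_omega_star_pseudocompact_def
proof (intro allI impI)
  interpret omega_extension X using assms by unfold_locales
  fix V :: "'i \<Rightarrow> nat \<Rightarrow> nat set set set set"
  assume V: "\<forall>i\<in>I. \<forall>n. openin (vietoris T) (V i n) \<and> V i n \<noteq> {}"
  \<comment> \<open>Each open set is replaced by a single isolated point in it; for \<open>i\<close>
    outside \<open>I\<close> any nonempty finite set will do.\<close>
  have "\<exists>F. finite F \<and> F \<noteq> {} \<and> (i \<in> I \<longrightarrow> principal_uf ` F \<in> V i n)" for i n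
  proof (cases "i \<in> I")
    case True
    then show ?thesis
      using V openin_vietoris_finite_mem[of "V i n"] by metis
  qed blast
  then obtain F where fin: "\<And>i n. finite (F i n)" "\<And>i n. F i n \<noteq> {}"
    and FV: "\<And>i n. i \<in> I \<Longrightarrow> principal_uf ` F i n \<in> V i n"
    by metis
  obtain A where "infinite A" and A: "\<And>i. i \<in> I \<Longrightarrow> splits_along (F i) A"
    using less_than_h_common[OF assms(4), where D = "\<lambda>i. {A. infinite A \<and> splits_along (F i) A}"]
      open_dense_splits_along[OF fin(1)] by auto
  define a where "a = enumerate A"
  have aA: "a k \<in> A" for k using \<open>infinite A\<close> by (simp add: a_def enumerate_in_set)
  have mono: "strict_mono a" using \<open>infinite A\<close> by (simp add: a_def strict_mono_enumerate)
  \<comment> \<open>Odd-numbered elements of \<open>A\<close> bound the blocks, and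
    \<open>e k\<close> is the even-numbered one between the two bounds of \<open>G k\<close>. Below
    the block \<open>F i (e k)\<close> will agree with a limit set, and it will end within the
    block, for every \<open>i\<close> in \<open>I\<close> and large \<open>k\<close>.\<close>
  define G where "G k = {a (2 * k + 1)..<a (2 * k + 3)}" for k
  define e where "e k = a (2 * k + 2)" for k
  have "G k \<inter> G l = {}" if "k < l" for k l
  proof -
    have "a (2 * k + 3) \<le> a (2 * l + 1)" using that mono by (simp add: strict_mono_less_eq)
    then show ?thesis by (auto simp: G_def)
  qed
  then have "G k \<inter> G l = {}" if "k \<noteq> l" for k l
    using that by (metis inf_commute nat_neq_iff)
  moreover have aG: "a (2 * k + 1) \<in> G k" for k
    using mono by (simp add: G_def strict_mono_less)
  moreover have "finite (G k)" for k by (simp add: G_def)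
  ultimately obtain p where p: "p \<in> omega_star"
    and sel: "\<forall>f. (\<forall>k. f k \<in> G k) \<longrightarrow> map_uf f p \<in> X"
    using map_uf_selector_mem[OF assms(3), where G = G] by blast
  note up = omega_star_ultrafilter[OF p]
  have "inj e" using mono by (auto simp: inj_def e_def strict_mono_eq)
  \<comment> \<open>\<open>p\<close> lives on block numbers \<open>k\<close>; the ultrafilter sought
    lives on indices \<open>n\<close> of the given sequences, so \<open>p\<close> is carried over by
    \<open>e\<close>.\<close>
  then have ep: "map_uf e p \<in> omega_star" using p map_uf_omega_star by blast
  show "\<exists>p\<in>omega_star. \<forall>i\<in>I. \<exists>z. p_limit (vietoris T) p (V i) z"
  proof (intro bexI[OF _ ep] ballI)
    fix i assume i: "i \<in> I"
    obtain R m where "\<forall>a\<in>A. \<forall>b\<in>A. m \<le> a \<and> a < b \<longrightarrow>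
       F i a \<subseteq> {..<b} \<and> F i b \<inter> {..<a} = R \<inter> {..<a}"
      using A[OF i] unfolding splits_along_def by (elim exE)
    then have Rm: "F i a \<subseteq> {..<b}" "F i b \<inter> {..<a} = R \<inter> {..<a}"
      if "a \<in> A" "b \<in> A" "m \<le> a" "a < b" for a b
      using that by simp_all
    \<comment> \<open>This turns the threshold \<open>m\<close> on elements of \<open>A\<close> into
      a threshold on block numbers.\<close>
    have ge: "k \<le> a (2 * k + 1)" for k
      using strict_mono_imp_increasing[OF mono, of "2 * k + 1"] by linarith
    have Fe: "F i (e k) \<subseteq> {..<a (2 * k + 3)}"
        "F i (e k) \<inter> {..<a (2 * k + 1)} = R \<inter> {..<a (2 * k + 1)}" if "m \<le> k" for k
    proof -
      have "m \<le> a (2 * k + 1)" using ge[of k] that by linarith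
      moreover have "a (2 * k + 1) < e k" "e k < a (2 * k + 3)"
        using mono by (auto simp: e_def strict_mono_less)
      ultimately show "F i (e k) \<subseteq> {..<a (2 * k + 3)}"
        "F i (e k) \<inter> {..<a (2 * k + 1)} = R \<inter> {..<a (2 * k + 1)}"
        using Rm(2)[of "a (2 * k + 1)" "e k"] Rm(1)[of "e k" "a (2 * k + 3)"] aA
        by (auto simp: e_def)
    qed
    have cofin: "{k. c \<le> k} \<in> p" for c
    proof (rule omega_star_cofinite[OF p])
      have "- {k. c \<le> k} = {..<c}" by auto
      then show "finite (- {k. c \<le> k})" by simp
    qed
    have "\<exists>K. p_limit (vietoris T) (map_uf e p) (\<lambda>n. {principal_uf ` F i n}) K"
    proof (rule ex_p_limit_finite[OF omega_star_ultrafilter[OF ep] fin])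
      fix B assume "{n. F i n \<inter> B \<noteq> {}} \<in> map_uf e p"
      then have S: "{k. F i (e k) \<inter> B \<noteq> {}} \<in> p" by (simp add: mem_map_uf)
      show "\<exists>q\<in>X. B \<in> q \<and> (\<forall>C\<in>q. {n. F i n \<inter> C \<noteq> {}} \<in> map_uf e p)"
      \<comment> \<open>If \<open>B\<close> meets \<open>R\<close>, a common point belongs to
        \<open>F i (e k)\<close> for all large \<open>k\<close> and its principal ultrafilter is the
        witness. Otherwise \<open>B\<close> meets \<open>F i (e k)\<close> only inside the block,
        and a selector is used.\<close>
      proof (cases "R \<inter> B = {}")
        case False
        then obtain r where r: "r \<in> R" "r \<in> B" by blast
        have "{n. F i n \<inter> C \<noteq> {}} \<in> map_uf e p" if "r \<in> C" for C
        proof -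
          have "r \<in> F i (e k)" if k: "max m (Suc r) \<le> k" for k
          proof -
            have "r \<in> R \<inter> {..<a (2 * k + 1)}" using ge[of k] r k by simp
            then show ?thesis using Fe(2)[of k] k by force
          qed
          then have sub: "{k. max m (Suc r) \<le> k} \<subseteq> {k. F i (e k) \<inter> C \<noteq> {}}"
            using \<open>r \<in> C\<close> by blast
          show ?thesis
            unfolding mem_map_uf mem_Collect_eq by (rule ultrafilter_nat_mono[OF up cofin sub])
        qed
        then show ?thesis using r principal_mem by (intro bexI[of _ "principal_uf r"]) auto
      next
        case True
        \<comment> \<open>The default, the left end of the block, keeps \<open>f\<close> a selector
          of \<open>G\<close> at every \<open>k\<close>, as \<open>sel\<close> requires.\<close>
        define f where "f k = (if F i (e k) \<inter> B \<inter> G k \<noteq> {}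
            then SOME x. x \<in> F i (e k) \<inter> B \<inter> G k else a (2 * k + 1))" for k
        have f: "f k \<in> F i (e k) \<inter> B \<inter> G k" if "F i (e k) \<inter> B \<inter> G k \<noteq> {}" for k
          using that someI_ex[of "\<lambda>x. x \<in> F i (e k) \<inter> B \<inter> G k"] by (auto simp: f_def)
        have fG: "f k \<in> G k" for k
          using f[of k] aG[of k] by (cases "F i (e k) \<inter> B \<inter> G k = {}") (auto simp: f_def)
        have "{k. F i (e k) \<inter> B \<noteq> {}} \<inter> {k. m \<le> k} \<in> p"
          using S cofin ultrafilter_nat_Int[OF up] by blast
        then have fT: "{k. f k \<in> F i (e k) \<inter> B} \<in> p"
        proof (rule ultrafilter_nat_mono[OF up], intro subsetI CollectI)
          fix k assume "k \<in> {k. F i (e k) \<inter> B \<noteq> {}} \<inter> {k. m \<le> k}"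
          then obtain x where x: "x \<in> F i (e k)" "x \<in> B" and k: "m \<le> k" by auto
          have "x \<notin> R" using x True by blast
          then have "\<not> x < a (2 * k + 1)" using Fe(2)[OF k] x by blast
          then have "x \<in> G k" using Fe(1)[OF k] x by (auto simp: G_def)
          then show "f k \<in> F i (e k) \<inter> B" using f[of k] x by blast
        qed
        have "B \<in> map_uf f p"
          unfolding mem_map_uf using fT by (rule ultrafilter_nat_mono[OF up]) auto
        moreover have "{n. F i n \<inter> C \<noteq> {}} \<in> map_uf e p" if "C \<in> map_uf f p" for C
        proof -
          have "{k. f k \<in> F i (e k) \<inter> B} \<inter> {k. f k \<in> C} \<in> p"
            using that fT ultrafilter_nat_Int[OF up] by (simp add: mem_map_uf)
          then have "{k. F i (e k) \<inter> C \<noteq> {}} \<in> p"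
            by (rule ultrafilter_nat_mono[OF up]) auto
          then show ?thesis by (simp add: mem_map_uf)
        qed
        ultimately show ?thesis using sel fG by blast
      qed
    qed
    then obtain K where K: "p_limit (vietoris T) (map_uf e p) (\<lambda>n. {principal_uf ` F i n}) K"
      by blast
    \<comment> \<open>A limit of the chosen points is a limit of the open sets containing
      them.\<close>
    have "p_limit (vietoris T) (map_uf e p) (V i) K"
      unfolding p_limit_def
    proof (intro conjI allI impI)
      show "K \<in> topspace (vietoris T)" using K by (simp add: p_limit_def)
      fix W assume "openin (vietoris T) W \<and> K \<in> W"
      then have "{n. W \<inter> {principal_uf ` F i n} \<noteq> {}} \<in> map_uf e p"
        using K by (simp add: p_limit_def)
      then show "{n. W \<inter> V i n \<noteq> {}} \<in> map_uf e p"
        by (rule ultrafilter_nat_mono[OF omega_star_ultrafilter[OF ep]]) (use FV[OF i] in blast)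
    qed
    then show "\<exists>z. p_limit (vietoris T) (map_uf e p) (V i) z" by blast
  qed
qed

end
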